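(* Let $\mathbf F=(F_1,\dots,F_n)$ with $F_i\in\mathbb Q[t][x_1,\dots,x_n]$, let $u=\lambda_1x_1+\cdots+\lambda_nx_n$, let $I=\langle t^k\rangle\subset\mathbb Q[t]$ for some $k\ge 1$, and let $q(T)\in\mathbb Q[t][T]$ and $\mathbf v(T)=(v_1(T),\dots,v_n(T))\in\mathbb Q[t][T]^n$ satisfy: 1. $q(T)$ is monic of degree $d$; 2. each $v_i(T)$ has degree at most $d-1$ (in $T$); 3. $\mathbf F(\mathbf v(T))\equiv 0 \bmod q(T) \bmod I$; 4. $\lambda_1v_1(T)+\cdots+\lambda_nv_n(T)\equiv T \bmod I$; 5. $J_{\mathbf F}(\mathbf v(T)):=\left[\frac{\partial F_i}{\partial x_j}(\mathbf v(T))\right]_{i,j=1}^n$ is invertible modulo $q(T)$ and $I$. Let $\mathbf w(T)$, $\Delta(T)$, $\mathbf V(T)$, $Q(T)$, $\tilde{\mathbf V}(T)$, $\tilde Q(T)$ be as in the context, and assume that $u$ is a primitive element for $\langle q(T),x_1-w_1(T),\dots,x_n-w_n(T)\rangle$ over $\mathbb Q[t]/I^2$. Then $$\mathbf V(T)\equiv\tilde{\mathbf V}(T)\quad\text{and}\quad Q(T)\equiv\tilde Q(T)\quad \bmod I^2 .$$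
   Context: All of the following is computed with coefficients in the ring $\mathbb Q[t]/I^2$; "$p\bmod q$" is the remainder on division by the monic polynomial $q$ (in the variable $T$). Common part: $\mathbf w(T)=(w_1,\dots,w_n):=\mathbf v(T)-\left(J_{\mathbf F}(\mathbf v(T))^{-1}\mathbf F(\mathbf v(T))\bmod q(T)\right)\bmod I^2$ and $\Delta(T):=\sum_{i=1}^n\lambda_iw_i(T)-T\bmod I^2$. Non-Archimedean global Newton iteration (Giusti–Lecerf–Salvy): $\mathbf V(T):=\mathbf w(T)-\left(\Delta(T)\cdot\frac{\partial\mathbf w(T)}{\partial T}\bmod q(T)\right)\bmod I^2$, $Q(T):=q(T)-\left(\Delta(T)\cdot\frac{\partial q(T)}{\partial T}\bmod q(T)\right)\bmod I^2$. Alternative construction (over $R=\mathbb Q[t]/I^2$): $\tilde{\mathbf V}(T)=(\tilde V_1,\dots,\tilde V_n)$ and $\Delta\tilde Q(T)$ are the polynomials over $R$ of degree at most $d-1$ in $T$ determined by $\tilde V_i(T+\Delta(T))\equiv w_i(T)\bmod q(T)$ $(i=1,\dots,n)$ and $\Delta\tilde Q(T+\Delta(T))\equiv-(T+\Delta(T))^d\bmod q(T)$, and $\tilde Q(T):=\Delta\tilde Q(T)+T^d$. The primitive element assumption means that $1,\,T+\Delta(T),\dots,(T+\Delta(T))^{d-1}$ form a basis of $R[T]/\langle q(T)\rangle$ over $R=\mathbb Q[t]/I^2$ (note $T+\Delta(T)=u(\mathbf w(T))$), so that $\tilde{\mathbf V}$ and $\tilde Q$ exist and are unique. *)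

theory Defs
  imports "HOL-Analysis.Cartesian_Space" "HOL-Library.Poly_Mapping"
    "HOL-Computational_Algebra.Polynomial"
begin

text \<open>
  Elements of \<open>\<rat>[t][T]\<close> have type \<open>rat poly poly\<close>: the outer variable is \<open>T\<close>, the
  inner one is \<open>t\<close>.  Elements of \<open>\<rat>[t][x\<^sub>1, \<dots>, x\<^sub>n]\<close> are finitely supported maps from
  exponent vectors to coefficients; the type \<open>'n\<close> indexes the \<open>n\<close> variables.
\<close>

type_synonym 'n mpol = "('n \<Rightarrow>\<^sub>0 nat) \<Rightarrow>\<^sub>0 rat poly"

definition mpol_eval :: "'n::finite mpol \<Rightarrow> rat poly poly ^ 'n \<Rightarrow> rat poly poly" where
  "mpol_eval f v =
     (\<Sum>m\<in>Poly_Mapping.keys f.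
        [:Poly_Mapping.lookup f m:] * (\<Prod>i\<in>UNIV. (v $ i) ^ Poly_Mapping.lookup m i))"

text \<open>
  Subtraction of exponents truncates at 0, but then the coefficient of the term vanishes.
\<close>

definition mpol_pderiv :: "'n \<Rightarrow> 'n::finite mpol \<Rightarrow> 'n mpol" where
  "mpol_pderiv j f =
     (\<Sum>m\<in>Poly_Mapping.keys f.
        Poly_Mapping.single (m - Poly_Mapping.single j 1)
          (of_nat (Poly_Mapping.lookup m j) * Poly_Mapping.lookup f m))"

definition mpols_eval :: "'n::finite mpol ^ 'n \<Rightarrow> rat poly poly ^ 'n \<Rightarrow> rat poly poly ^ 'n" where
  "mpols_eval F v = (\<chi> i. mpol_eval (F $ i) v)"

definition jacobian_at ::
    "'n::finite mpol ^ 'n \<Rightarrow> rat poly poly ^ 'n \<Rightarrow> rat poly poly ^ 'n ^ 'n" where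
  "jacobian_at F v = (\<chi> i j. mpol_eval (mpol_pderiv j (F $ i)) v)"

definition lin_form :: "rat poly ^ 'n::finite \<Rightarrow> rat poly poly ^ 'n \<Rightarrow> rat poly poly" where
  "lin_form l v = (\<Sum>i\<in>UNIV. smult (l $ i) (v $ i))"

abbreviation var_T :: "rat poly poly" where
  "var_T \<equiv> [:0, 1:]"

text \<open>
  Degree at most \<open>d - 1\<close>, where the zero polynomial has degree \<open>-\<infinity>\<close>.
\<close>

definition deg_less :: "nat \<Rightarrow> rat poly poly \<Rightarrow> bool" where
  "deg_less d p \<longleftrightarrow> (\<forall>i\<ge>d. coeff p i = 0)"

text \<open>
  Since \<open>I = \<langle>t\<^sup>k\<rangle>\<close>, reduction modulo \<open>I\<close> and modulo \<open>I\<^sup>2\<close> are the cases \<open>m = k\<close> and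
  \<open>m = 2 * k\<close> of reduction modulo \<open>t\<^sup>m\<close>.
  \<open>cong_t m\<close> is equality in \<open>(\<rat>[t]/\<langle>t\<^sup>m\<rangle>)[T]\<close>, and \<open>cong_qt m q\<close> is equality in
  \<open>(\<rat>[t]/\<langle>t\<^sup>m\<rangle>)[T]/\<langle>q\<rangle>\<close>.
\<close>

definition cong_t :: "nat \<Rightarrow> rat poly poly \<Rightarrow> rat poly poly \<Rightarrow> bool" where
  "cong_t m p r \<longleftrightarrow> [:monom 1 m:] dvd (p - r)"

definition cong_qt ::
    "nat \<Rightarrow> rat poly poly \<Rightarrow> rat poly poly \<Rightarrow> rat poly poly \<Rightarrow> bool" where
  "cong_qt m q p r \<longleftrightarrow> (\<exists>a b. p - r = q * a + [:monom 1 m:] * b)"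

text \<open>
  The representative in \<open>\<rat>[t][T]\<close>, with coefficients of degree less than \<open>m\<close> in \<open>t\<close>, of
  the class of \<open>p\<close> in \<open>(\<rat>[t]/\<langle>t\<^sup>m\<rangle>)[T]\<close>.
\<close>

definition trunc_t :: "nat \<Rightarrow> rat poly poly \<Rightarrow> rat poly poly" where
  "trunc_t m p = map_poly (\<lambda>c. c mod monom 1 m) p"

text \<open>
  For monic \<open>q\<close> pseudo-division is ordinary division with remainder.
\<close>

abbreviation rem_monic :: "rat poly poly \<Rightarrow> rat poly poly \<Rightarrow> rat poly poly" where
  "rem_monic p q \<equiv> pseudo_mod p q"

definition is_inverse_qt ::
    "nat \<Rightarrow> rat poly poly \<Rightarrow> rat poly poly ^ 'n ^ 'n::finite \<Rightarrow> rat poly poly ^ 'n ^ 'n \<Rightarrow> bool" where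
  "is_inverse_qt m q A B \<longleftrightarrow>
     (\<forall>i j. cong_qt m q ((A ** B) $ i $ j) (mat 1 $ i $ j) \<and>
            cong_qt m q ((B ** A) $ i $ j) (mat 1 $ i $ j))"

definition invertible_qt :: "nat \<Rightarrow> rat poly poly \<Rightarrow> rat poly poly ^ 'n ^ 'n::finite \<Rightarrow> bool" where
  "invertible_qt m q A \<longleftrightarrow> (\<exists>B. is_inverse_qt m q A B)"

text \<open>
  Some representative of the inverse matrix over \<open>(\<rat>[t]/\<langle>t\<^sup>m\<rangle>)[T]/\<langle>q\<rangle>\<close>; the inverse itself
  is unique as a matrix over that ring.
\<close>

definition inverse_qt ::
    "nat \<Rightarrow> rat poly poly \<Rightarrow> rat poly poly ^ 'n ^ 'n::finite \<Rightarrow> rat poly poly ^ 'n ^ 'n" where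
  "inverse_qt m q A = (SOME B. is_inverse_qt m q A B)"

definition newton_w ::
    "nat \<Rightarrow> rat poly poly \<Rightarrow> 'n::finite mpol ^ 'n \<Rightarrow> rat poly poly ^ 'n \<Rightarrow> rat poly poly ^ 'n" where
  "newton_w k q F v =
     (\<chi> i. trunc_t (2 * k)
        (v $ i - rem_monic ((inverse_qt (2 * k) q (jacobian_at F v) *v mpols_eval F v) $ i) q))"

definition newton_Delta ::
    "nat \<Rightarrow> rat poly ^ 'n::finite \<Rightarrow> rat poly poly ^ 'n \<Rightarrow> rat poly poly" where
  "newton_Delta k l w = trunc_t (2 * k) (lin_form l w - var_T)"

definition newton_V ::
    "nat \<Rightarrow> rat poly poly \<Rightarrow> rat poly poly ^ 'n::finite \<Rightarrow> rat poly poly \<Rightarrow> rat poly poly ^ 'n" where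
  "newton_V k q w \<Delta> = (\<chi> i. trunc_t (2 * k) (w $ i - rem_monic (\<Delta> * pderiv (w $ i)) q))"

definition newton_Q :: "nat \<Rightarrow> rat poly poly \<Rightarrow> rat poly poly \<Rightarrow> rat poly poly" where
  "newton_Q k q \<Delta> = trunc_t (2 * k) (q - rem_monic (\<Delta> * pderiv q) q)"

text \<open>
  Modulo \<open>\<langle>q, x\<^sub>1 - w\<^sub>1, \<dots>, x\<^sub>n - w\<^sub>n\<rangle>\<close> the linear form \<open>u\<close> is \<open>u(w)\<close>.  It is a primitive
  element if its powers with exponents below the degree of \<open>q\<close> form a basis of
  \<open>R[T]/\<langle>q\<rangle>\<close> as a module over \<open>R = \<rat>[t]/\<langle>t\<^sup>m\<rangle>\<close>: they span it and are linearly independent.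
\<close>

definition primitive_element ::
    "nat \<Rightarrow> rat poly poly \<Rightarrow> rat poly ^ 'n::finite \<Rightarrow> rat poly poly ^ 'n \<Rightarrow> bool" where
  "primitive_element m q l w \<longleftrightarrow>
     (\<forall>p. \<exists>c :: nat \<Rightarrow> rat poly.
        cong_qt m q (\<Sum>i<degree q. smult (c i) (lin_form l w ^ i)) p) \<and>
     (\<forall>c :: nat \<Rightarrow> rat poly.
        cong_qt m q (\<Sum>i<degree q. smult (c i) (lin_form l w ^ i)) 0 \<longrightarrow>
        (\<forall>i<degree q. monom 1 m dvd c i))"

text \<open>
  The polynomial \<open>p\<close> over \<open>\<rat>[t]/\<langle>t\<^sup>m\<rangle>\<close> of degree less than that of \<open>q\<close> with
  \<open>p(y) = r\<close> modulo \<open>q\<close>, given by its truncated representative, which makes it unique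
  in \<open>\<rat>[t][T]\<close>.
\<close>

definition poly_solution ::
    "nat \<Rightarrow> rat poly poly \<Rightarrow> rat poly poly \<Rightarrow> rat poly poly \<Rightarrow> rat poly poly" where
  "poly_solution m q y r =
     (THE p. deg_less (degree q) p \<and> trunc_t m p = p \<and> cong_qt m q (pcompose p y) r)"

definition alt_V ::
    "nat \<Rightarrow> rat poly poly \<Rightarrow> rat poly poly ^ 'n::finite \<Rightarrow> rat poly poly \<Rightarrow> rat poly poly ^ 'n" where
  "alt_V k q w \<Delta> = (\<chi> i. poly_solution (2 * k) q (var_T + \<Delta>) (w $ i))"

definition alt_Q :: "nat \<Rightarrow> rat poly poly \<Rightarrow> rat poly poly \<Rightarrow> rat poly poly" where
  "alt_Q k q \<Delta> =
     poly_solution (2 * k) q (var_T + \<Delta>) (- ((var_T + \<Delta>) ^ degree q)) + var_T ^ degree q"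

end

theory Submission
  imports Defs
begin

text \<open>
  Since \<open>w \<equiv> v\<close> modulo \<open>I\<close>, also \<open>\<Delta> \<equiv> 0\<close> modulo \<open>I\<close>, so \<open>\<Delta>\<^sup>2\<close> vanishes modulo \<open>I\<^sup>2\<close> and Taylor
  expansion gives \<open>p(T + \<Delta>) \<equiv> p + \<Delta> * p'\<close>.  Hence \<open>p \<mapsto> p - \<Delta> * p'\<close> undoes the substitution
  \<open>T \<mapsto> T + \<Delta>\<close> modulo \<open>q\<close>: the polynomials \<open>V\<^sub>i\<close> and \<open>Q - T\<^sup>d\<close> solve the equations that define
  the alternative construction, and the solutions are unique because \<open>T + \<Delta> \<equiv> u(w)\<close> is primitive.
\<close>

section \<open>Congruence modulo powers of \<open>t\<close> and truncated representatives\<close>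

lemma cong_t_iff_coeff: "cong_t m p r \<longleftrightarrow> (\<forall>i. monom 1 m dvd coeff p i - coeff r i)"
  by (simp add: cong_t_def const_poly_dvd_iff)

lemma cong_t_trans: "cong_t m p r \<Longrightarrow> cong_t m r s \<Longrightarrow> cong_t m p s"
  using dvd_add[of "[:monom 1 m:]" "p - r" "r - s"] by (simp add: cong_t_def)

lemma cong_t_le: "cong_t m p r \<Longrightarrow> j \<le> m \<Longrightarrow> cong_t j p r"
  unfolding cong_t_iff_coeff by (metis dvd_trans le_imp_power_dvd monom_altdef smult_1_left)

lemma cong_t_diff_left: "cong_t m r 0 \<Longrightarrow> cong_t m (p - r) p"
  by (simp add: cong_t_def)

lemma cong_t_pderiv: "cong_t m p r \<Longrightarrow> cong_t m (pderiv p) (pderiv r)"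
  unfolding cong_t_iff_coeff
  by (simp add: coeff_pderiv flip: right_diff_distrib)

lemma coeff_trunc_t: "coeff (trunc_t m p) i = coeff p i mod monom 1 m"
  by (simp add: trunc_t_def coeff_map_poly)

lemma cong_t_trunc_t: "cong_t m (trunc_t m p) p"
  unfolding cong_t_iff_coeff coeff_trunc_t
  by (metis mod_eq_dvd_iff mod_mod_trivial)

lemma trunc_t_trunc_t [simp]: "trunc_t m (trunc_t m p) = trunc_t m p"
  by (simp add: poly_eq_iff coeff_trunc_t)

lemma trunc_t_eq_iff: "trunc_t m p = trunc_t m r \<longleftrightarrow> cong_t m p r"
  by (simp add: poly_eq_iff[of "trunc_t m p"] coeff_trunc_t cong_t_iff_coeff mod_eq_dvd_iff)

lemma trunc_t_diff: "trunc_t m (p - r) = trunc_t m p - trunc_t m r"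
  by (simp add: poly_eq_iff coeff_trunc_t poly_mod_diff_left)

text \<open>For \<open>m = 0\<close> the modulus would be the unit 1 and the remainder 0. Through
  this lemma the main theorem uses \<open>k \<ge> 1\<close>.\<close>

lemma one_mod_monom: "m \<ge> 1 \<Longrightarrow> (1 :: rat poly) mod monom 1 m = 1"
  by (rule mod_poly_less) (simp add: degree_monom_eq)

lemma var_T_power: "var_T ^ d = monom 1 d"
  by (simp add: monom_altdef)

lemma trunc_t_var_T_power: "m \<ge> 1 \<Longrightarrow> trunc_t m (var_T ^ d) = var_T ^ d"
  by (simp add: poly_eq_iff[of "trunc_t m p" for p] coeff_trunc_t one_mod_monom var_T_power)

lemma deg_less_trunc_t: "deg_less d p \<Longrightarrow> deg_less d (trunc_t m p)"
  by (simp add: deg_less_def coeff_trunc_t)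

lemma deg_less_diff: "deg_less d p \<Longrightarrow> deg_less d r \<Longrightarrow> deg_less d (p - r)"
  by (simp add: deg_less_def)

section \<open>Division by a monic polynomial\<close>

lemma rem_monic_eq:
  assumes "lead_coeff q = 1"
  obtains s where "p = q * s + rem_monic p q"
proof -
  have "q \<noteq> 0" using assms by auto
  obtain s r where sr: "pseudo_divmod p q = (s, r)" by fastforce
  from pseudo_divmod(1)[OF \<open>q \<noteq> 0\<close> this] have "p = q * s + r"
    using assms by simp
  with sr that[of s] show thesis by (simp add: pseudo_mod_def)
qed

lemma deg_less_rem_monic:
  assumes "lead_coeff q = 1"
  shows "deg_less (degree q) (rem_monic p q)"
proof -
  have "q \<noteq> 0" using assms by auto
  then show ?thesis
    using pseudo_mod(2)[of q p] by (auto simp: deg_less_def coeff_eq_0)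
qed

lemma monic_dvd_deg_less:
  assumes "lead_coeff q = 1" "deg_less (degree q) (q * a)"
  shows "a = 0"
proof (rule ccontr)
  assume "a \<noteq> 0"
  have "q \<noteq> 0" using assms by auto
  have "coeff (q * a) (degree q + degree a) = lead_coeff a"
    using assms(1) by (simp add: coeff_mult_degree_sum)
  with assms(2) \<open>a \<noteq> 0\<close> show False by (simp add: deg_less_def)
qed

text \<open>Reducing the cofactor of \<open>t^m\<close> modulo \<open>q\<close> leaves a multiple of
  \<open>q\<close> of degree below that of \<open>q\<close>, which is 0 because \<open>q\<close> is
  monic. This turns vanishing of a class modulo \<open>q\<close> into vanishing of its
  remainder.\<close>

lemma cong_qt_deg_less_imp_cong_t:
  assumes q: "lead_coeff q = 1" and r: "deg_less (degree q) r" and "cong_qt m q r 0"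
  shows "cong_t m r 0"
proof -
  obtain a b where ab: "r = q * a + [:monom 1 m:] * b"
    using assms(3) by (auto simp: cong_qt_def)
  obtain s where s: "b = q * s + rem_monic b q"
    using rem_monic_eq[OF q] .
  have "r - [:monom 1 m:] * rem_monic b q = q * (a + [:monom 1 m:] * s)"
    by (subst ab, subst (1) s) (simp add: algebra_simps)
  moreover have "deg_less (degree q) (r - [:monom 1 m:] * rem_monic b q)"
    using r deg_less_rem_monic[OF q, of b] by (simp add: deg_less_def)
  ultimately have "r - [:monom 1 m:] * rem_monic b q = 0"
    using monic_dvd_deg_less[OF q] by (metis mult_zero_right)
  then have "r = [:monom 1 m:] * rem_monic b q" by (rule eq_iff_diff_eq_0[THEN iffD2])
  then show ?thesis unfolding cong_t_def diff_0_right by (rule dvdI)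
qed

section \<open>Calculus of congruences modulo \<open>q\<close> and \<open>t^m\<close>\<close>

lemma cong_t_imp_cong_qt: "cong_t m p r \<Longrightarrow> cong_qt m q p r"
  unfolding cong_t_def cong_qt_def by (metis add_0 dvdE mult_zero_right)

lemma cong_qt_refl: "cong_qt m q p p"
  by (simp add: cong_t_imp_cong_qt cong_t_def)

lemma cong_qt_sym: "cong_qt m q p r \<Longrightarrow> cong_qt m q r p"
  unfolding cong_qt_def
  by (metis minus_diff_eq minus_add_distrib mult_minus_right)

lemma cong_qt_add:
  assumes "cong_qt m q p r" "cong_qt m q p' r'"
  shows "cong_qt m q (p + p') (r + r')"
proof -
  obtain a b a' b' where "p - r = q * a + [:monom 1 m:] * b" "p' - r' = q * a' + [:monom 1 m:] * b'"
    using assms by (auto simp: cong_qt_def)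
  then have "(p + p') - (r + r') = q * (a + a') + [:monom 1 m:] * (b + b')"
    by (simp only: add_diff_add distrib_left distrib_right ac_simps)
  then show ?thesis unfolding cong_qt_def by blast
qed

lemma cong_qt_mult_left:
  assumes "cong_qt m q p r"
  shows "cong_qt m q (s * p) (s * r)"
proof -
  obtain a b where "p - r = q * a + [:monom 1 m:] * b"
    using assms by (auto simp: cong_qt_def)
  then have "s * p - s * r = q * (s * a) + [:monom 1 m:] * (s * b)"
    by (simp only: distrib_left flip: right_diff_distrib) (simp only: ac_simps)
  then show ?thesis unfolding cong_qt_def by blast
qed

lemma cong_qt_trans: "cong_qt m q p r \<Longrightarrow> cong_qt m q r s \<Longrightarrow> cong_qt m q p s"
  using cong_qt_add[of m q p r r s] unfolding cong_qt_def by simp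

lemma cong_qt_diff:
  assumes "cong_qt m q p r" "cong_qt m q p' r'"
  shows "cong_qt m q (p - p') (r - r')"
  using cong_qt_add[OF assms(1) cong_qt_mult_left[OF assms(2), of "-1"]] by simp

lemma cong_qt_mult:
  assumes "cong_qt m q p r" "cong_qt m q p' r'"
  shows "cong_qt m q (p * p') (r * r')"
  using cong_qt_trans[OF cong_qt_mult_left[OF assms(2), of p]] cong_qt_mult_left[OF assms(1), of r']
  by (simp add: mult.commute)

lemma cong_qt_power: "cong_qt m q p r \<Longrightarrow> cong_qt m q (p ^ n) (r ^ n)"
  by (induction n) (auto intro: cong_qt_refl cong_qt_mult)

lemma cong_qt_sum: "(\<And>i. i \<in> A \<Longrightarrow> cong_qt m q (f i) (g i)) \<Longrightarrow> cong_qt m q (sum f A) (sum g A)"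
  by (induction A rule: infinite_finite_induct) (auto intro: cong_qt_refl cong_qt_add)

lemma cong_qt_rem_monic:
  assumes "lead_coeff q = 1"
  shows "cong_qt m q (rem_monic p q) p"
proof -
  obtain s where "p = q * s + rem_monic p q"
    using rem_monic_eq[OF assms] .
  then have "rem_monic p q - p = q * (- s) + [:monom 1 m:] * 0"
    by (simp add: algebra_simps)
  then show ?thesis unfolding cong_qt_def by blast
qed

section \<open>First-order Taylor expansion and the Newton step\<close>

lemma pcompose_taylor:
  fixes p h :: "'a::idom poly"
  shows "h\<^sup>2 dvd pcompose p ([:0, 1:] + h) - (p + h * pderiv p)"
proof (induction p)
  case (pCons a p)
  \<comment> \<open>By Horner's rule the new error is \<open>T + h\<close> times the old error plus
    \<open>h^2 * p'\<close>.\<close>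
  have "pcompose (pCons a p) ([:0, 1:] + h) - (pCons a p + h * pderiv (pCons a p)) =
      ([:0, 1:] + h) * (pcompose p ([:0, 1:] + h) - (p + h * pderiv p)) + h\<^sup>2 * pderiv p"
    by (simp add: pcompose_pCons pderiv_pCons power2_eq_square algebra_simps)
  with pCons.IH show ?case by (metis dvd_add dvd_mult dvd_triv_left)
qed simp

lemma cong_qt_pcompose:
  assumes "cong_t k \<Delta> 0"
  shows "cong_qt (2 * k) q (pcompose p (var_T + \<Delta>)) (p + \<Delta> * pderiv p)"
proof -
  have "[:monom 1 k:]\<^sup>2 dvd \<Delta>\<^sup>2"
    using assms by (simp add: cong_t_def dvd_power_same)
  moreover have "[:monom 1 k:]\<^sup>2 = [:monom 1 (2 * k) :: rat poly:]"
    by (simp add: power2_eq_square mult_monom mult_2)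
  ultimately show ?thesis
    using dvd_trans[OF _ pcompose_taylor] by (metis cong_t_def cong_t_imp_cong_qt)
qed

text \<open>One factor \<open>t^k\<close> comes from \<Delta> and one from \<open>p - r\<close>: the
  derivative in the first-order term matters only modulo \<open>t^k\<close>.\<close>

lemma cong_t_mult_square:
  assumes "cong_t k \<Delta> 0" "cong_t k p r"
  shows "cong_t (2 * k) (\<Delta> * p) (\<Delta> * r)"
proof -
  have "[:monom 1 k:] * [:monom 1 k:] dvd \<Delta> * (p - r)"
    using assms by (simp only: cong_t_def diff_0_right mult_dvd_mono)
  then show ?thesis by (simp add: cong_t_def mult_monom mult_2 right_diff_distrib)
qed

text \<open>As \<open>P\<close> and \<open>p\<close> agree modulo \<open>t^k\<close>, \<Delta> times
  their derivatives agree modulo \<open>t^(2k)\<close>. So the first-order term of P(T + \<Delta>)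
  cancels the correction that was subtracted from \<open>p\<close>. Both the \<open>w_i\<close> and
  \<open>q\<close> take the role of \<open>p\<close>.\<close>

lemma pcompose_newton_step:
  assumes "lead_coeff q = 1" and \<Delta>: "cong_t k \<Delta> 0"
    and P: "P = trunc_t (2 * k) (p - rem_monic (\<Delta> * pderiv p) q)"
  shows "cong_qt (2 * k) q (pcompose P (var_T + \<Delta>)) p"
proof -
  let ?r = "rem_monic (\<Delta> * pderiv p) q"
  have P1: "cong_t (2 * k) P (p - ?r)"
    unfolding P by (rule cong_t_trunc_t)
  have "cong_qt k q (\<Delta> * pderiv p) 0"
    using cong_qt_mult_left[OF cong_t_imp_cong_qt[OF \<Delta>], of q "pderiv p"] by (simp add: mult.commute)
  then have "cong_t k ?r 0"
    by (intro cong_qt_deg_less_imp_cong_t[OF assms(1) deg_less_rem_monic[OF assms(1)]]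
        cong_qt_trans[OF cong_qt_rem_monic[OF assms(1)]])
  then have "cong_t k P p"
    using cong_t_trans[OF cong_t_le[OF P1]] by (simp add: cong_t_diff_left)
  then have "cong_qt (2 * k) q (\<Delta> * pderiv P) (\<Delta> * pderiv p)"
    by (intro cong_t_imp_cong_qt cong_t_mult_square[OF \<Delta>] cong_t_pderiv)
  moreover have "cong_qt (2 * k) q P (p - \<Delta> * pderiv p)"
    by (rule cong_qt_trans[OF cong_t_imp_cong_qt[OF P1]])
      (intro cong_qt_diff cong_qt_refl cong_qt_rem_monic assms(1))
  ultimately have "cong_qt (2 * k) q (P + \<Delta> * pderiv P) (p - \<Delta> * pderiv p + \<Delta> * pderiv p)"
    by (intro cong_qt_add)
  then show ?thesis
    using cong_qt_trans[OF cong_qt_pcompose[OF \<Delta>]] by simp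
qed

section \<open>Uniqueness from primitivity\<close>

text \<open>The difference of two solutions, evaluated at \<open>y\<close>, is a vanishing
  combination of powers of \<open>u(w)\<close> below \<open>degree q\<close>. The independence half
  of primitivity kills its coefficients modulo \<open>t^m\<close>.\<close>

lemma poly_solution_eqI:
  assumes prim: "primitive_element m q l w" and y: "cong_t m y (lin_form l w)"
    and p: "deg_less (degree q) p" "trunc_t m p = p" "cong_qt m q (pcompose p y) r"
  shows "poly_solution m q y r = p"
  unfolding poly_solution_def
proof (rule the_equality)
  fix p'
  assume p': "deg_less (degree q) p' \<and> trunc_t m p' = p' \<and> cong_qt m q (pcompose p' y) r"
  define c where "c = coeff (p' - p)"
  have deg: "deg_less (degree q) (p' - p)"
    using p p' by (intro deg_less_diff) auto
  have "pcompose (p' - p) y = (\<Sum>i<degree q. smult (c i) (y ^ i))"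
  proof -
    have "pcompose (p' - p) y = (\<Sum>i\<le>degree (p' - p). smult (c i) (y ^ i))"
      by (simp add: pcompose_altdef poly_altdef coeff_map_poly degree_map_poly c_def)
    \<comment> \<open>The union avoids comparing the index sets: if \<open>degree q = 0\<close>,
      then \<open>p' - p\<close> is 0 and \<open>{..0}\<close> is not contained in
      \<open>{..<0}\<close>.\<close>
    also have "\<dots> = (\<Sum>i\<in>{..<degree q} \<union> {..degree (p' - p)}. smult (c i) (y ^ i))"
      by (rule sum.mono_neutral_left) (auto simp: c_def simp del: coeff_diff intro: coeff_eq_0)
    also have "\<dots> = (\<Sum>i<degree q. smult (c i) (y ^ i))"
      using deg by (intro sum.mono_neutral_right) (auto simp: c_def deg_less_def)
    finally show ?thesis .
  qed
  moreover have "cong_qt m q (pcompose p' y - pcompose p y) (r - r)"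
    using p p' by (intro cong_qt_diff) auto
  ultimately have "cong_qt m q (\<Sum>i<degree q. smult (c i) (y ^ i)) 0"
    by (simp add: pcompose_diff)
  moreover have "cong_qt m q (\<Sum>i<degree q. smult (c i) (lin_form l w ^ i)) (\<Sum>i<degree q. smult (c i) (y ^ i))"
  proof (rule cong_qt_sum)
    fix i
    have "cong_qt m q (lin_form l w ^ i) (y ^ i)"
      by (intro cong_qt_power cong_qt_sym[OF cong_t_imp_cong_qt] y)
    from cong_qt_mult_left[OF this, of "[:c i:]"]
    show "cong_qt m q (smult (c i) (lin_form l w ^ i)) (smult (c i) (y ^ i))" by simp
  qed
  ultimately have "\<forall>i<degree q. monom 1 m dvd c i"
    using prim cong_qt_trans unfolding primitive_element_def by blast
  then have "cong_t m p' p"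
    using deg by (metis c_def coeff_diff cong_t_iff_coeff deg_less_def dvd_0_right not_le)
  then show "p' = p"
    using p p' trunc_t_eq_iff by metis
qed (use p in simp)

text \<open>
  \<open>F(v)\<close> vanishes modulo \<open>q\<close> and \<open>I\<close>, hence so does its product with whatever matrix the
  choice operator in \<open>inverse_qt\<close> denotes.
\<close>

lemma newton_w_cong:
  assumes q: "lead_coeff q = 1" and F: "\<And>i. cong_qt k q (mpols_eval F v $ i) 0"
  shows "cong_t k (newton_w k q F v $ i) (v $ i)"
proof -
  define B where "B = inverse_qt (2 * k) q (jacobian_at F v)"
  have "cong_qt k q ((B *v mpols_eval F v) $ i) (\<Sum>j\<in>UNIV. B $ i $ j * 0)"
    unfolding matrix_vector_mult_def vec_lambda_beta by (intro cong_qt_sum cong_qt_mult_left F)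
  then have "cong_qt k q ((B *v mpols_eval F v) $ i) 0" by simp
  then have "cong_t k (rem_monic ((B *v mpols_eval F v) $ i) q) 0"
    by (intro cong_qt_deg_less_imp_cong_t[OF q deg_less_rem_monic[OF q]]
        cong_qt_trans[OF cong_qt_rem_monic[OF q]])
  then show ?thesis
    using cong_t_trans[OF cong_t_le[OF cong_t_trunc_t[of "2 * k"]] cong_t_diff_left]
    by (simp add: newton_w_def B_def)
qed

lemma lin_form_cong:
  assumes "\<And>i. cong_t m (v $ i) (w $ i)"
  shows "cong_t m (lin_form l v) (lin_form l w)"
proof -
  have "lin_form l v - lin_form l w = (\<Sum>i\<in>UNIV. [:l $ i:] * (v $ i - w $ i))"
    by (simp add: lin_form_def smult_diff_right sum_subtractf)
  then show ?thesis
    using assms unfolding cong_t_def by (metis (no_types, lifting) dvd_mult dvd_sum)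
qed

theorem proposition8:
  fixes F :: "('n::finite) mpol ^ 'n"
    and l :: "rat poly ^ 'n"
    and k d :: nat
    and q :: "rat poly poly"
    and v w V Vt :: "rat poly poly ^ 'n"
    and \<Delta> Q Qt :: "rat poly poly"
  assumes "k \<ge> 1"
    and "lead_coeff q = 1" and "degree q = d"
    and "\<And>i. deg_less d (v $ i)"
    and "\<And>i. cong_qt k q (mpols_eval F v $ i) 0"
    and "cong_t k (lin_form l v) var_T"
    and "invertible_qt k q (jacobian_at F v)"
    and "w = newton_w k q F v"
    and "\<Delta> = newton_Delta k l w"
    and "V = newton_V k q w \<Delta>"
    and "Q = newton_Q k q \<Delta>"
    and "Vt = alt_V k q w \<Delta>"
    and "Qt = alt_Q k q \<Delta>"
    and "primitive_element (2 * k) q l w"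
  shows "(\<forall>i. cong_t (2 * k) (V $ i) (Vt $ i)) \<and> cong_t (2 * k) Q Qt"
proof -
  note q = assms(2) and d = assms(3)
  \<comment> \<open>The Newton correction vanishes modulo \<open>t^k\<close>, so \<open>u(w)\<close>
    inherits from \<open>u(v)\<close> the congruence to \<open>T\<close>.\<close>
  have "cong_t k (lin_form l w) var_T"
    using cong_t_trans[OF lin_form_cong assms(6)] newton_w_cong[OF q assms(5)] assms(8) by blast
  then have "cong_t k (lin_form l w - var_T) 0"
    by (simp add: cong_t_def)
  moreover have \<Delta>_cong: "cong_t (2 * k) \<Delta> (lin_form l w - var_T)"
    by (simp add: assms(9) newton_Delta_def cong_t_trunc_t)
  ultimately have \<Delta>: "cong_t k \<Delta> 0"
    using cong_t_trans cong_t_le by (metis le_add2 mult_2)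
  have y: "cong_t (2 * k) (var_T + \<Delta>) (lin_form l w)"
    using \<Delta>_cong by (simp add: cong_t_def algebra_simps)
  have V_eq: "V $ i = Vt $ i" for i
  proof -
    \<comment> \<open>Truncation and subtraction of remainders keep the degree bound of
      \<open>v_i\<close>, first for \<open>w_i\<close> and then for \<open>V_i\<close>.\<close>
    have "deg_less d (w $ i)"
      using assms(4) deg_less_rem_monic[OF q] d
      by (simp add: assms(8) newton_w_def deg_less_trunc_t deg_less_diff)
    then have "deg_less (degree q) (V $ i)"
      using deg_less_rem_monic[OF q] d
      by (simp add: assms(10) newton_V_def deg_less_trunc_t deg_less_diff)
    then have "poly_solution (2 * k) q (var_T + \<Delta>) (w $ i) = V $ i"
      by (intro poly_solution_eqI[OF assms(14) y] pcompose_newton_step[OF q \<Delta>])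
        (simp_all add: assms(10) newton_V_def)
    then show ?thesis by (simp add: assms(12) alt_V_def)
  qed
  have "Q - var_T ^ d = poly_solution (2 * k) q (var_T + \<Delta>) (- ((var_T + \<Delta>) ^ d))"
  proof (rule poly_solution_eqI[OF assms(14) y, symmetric])
    \<comment> \<open>The leading term of the monic \<open>q\<close> cancels against
      \<open>T^d\<close>.\<close>
    have "coeff q i = coeff (var_T ^ d) i" if "i \<ge> d" for i
      using that q d by (cases "i = d") (auto simp: coeff_eq_0 var_T_power)
    then have "deg_less d (q - var_T ^ d)"
      by (simp add: deg_less_def)
    then have "deg_less d (q - var_T ^ d - rem_monic (\<Delta> * pderiv q) q)"
      using deg_less_rem_monic[OF q] d deg_less_diff by blast
    moreover have "Q - var_T ^ d = trunc_t (2 * k) (q - var_T ^ d - rem_monic (\<Delta> * pderiv q) q)"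
      using assms(1) by (simp add: assms(11) newton_Q_def trunc_t_diff trunc_t_var_T_power)
    ultimately show "deg_less (degree q) (Q - var_T ^ d)" "trunc_t (2 * k) (Q - var_T ^ d) = Q - var_T ^ d"
      using d by (simp_all add: deg_less_trunc_t)
    \<comment> \<open>The Newton step for \<open>q\<close> itself makes Q(T + \<Delta>) vanish
      modulo \<open>q\<close>. Subtracting (T + \<Delta>)^d then gives the equation for the lower
      part of \<open>Qt\<close>.\<close>
    have "cong_qt (2 * k) q (pcompose Q (var_T + \<Delta>)) q"
      by (rule pcompose_newton_step[OF q \<Delta>]) (simp add: assms(11) newton_Q_def)
    moreover have "cong_qt (2 * k) q q 0"
      unfolding cong_qt_def by (metis add.right_neutral diff_0_right mult.right_neutral mult_zero_right)
    ultimately have "cong_qt (2 * k) q (pcompose Q (var_T + \<Delta>) - (var_T + \<Delta>) ^ d) (0 - (var_T + \<Delta>) ^ d)"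
      by (intro cong_qt_diff[OF cong_qt_trans cong_qt_refl])
    moreover have "pcompose (var_T ^ d) (var_T + \<Delta>) = (var_T + \<Delta>) ^ d"
      by (induction d) (simp_all add: pcompose_1 pcompose_mult pcompose_pCons)
    ultimately show "cong_qt (2 * k) q (pcompose (Q - var_T ^ d) (var_T + \<Delta>)) (- ((var_T + \<Delta>) ^ d))"
      by (simp add: pcompose_diff)
  qed
  then have "Q = Qt"
    unfolding assms(13) alt_Q_def d by (metis diff_add_cancel)
  with V_eq show ?thesis
    by (simp add: cong_t_def)
qed

end
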